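(* Let $\ell\ge 1$ and $k\ge 2$ be integers and suppose $H_k$ is nonsingular. Let ${\bf y}_{\ell,k}(t)=V_{k}\varphi_{\ell}(-tH_{k})\beta{\bf e}_{1}$ and $\widehat{\bf y}_{\ell,k}(t)=V_{k}\varphi_{\ell}(-tT_{k})\beta{\bf e}_{1}$ be the approximations to $\varphi_\ell(-tA){\bf v}$ obtained from the Arnoldi method and the harmonic Arnoldi method, and denote the corresponding residuals by $${\bf r}_{\ell,k}(t)=-A{\bf y}_{\ell,k}(t)-\tfrac{\ell}{t}{\bf y}_{\ell,k}(t)+\tfrac{1}{t(\ell-1)!}{\bf v}-{\bf y}_{\ell,k}'(t),\qquad \widehat{\bf r}_{\ell,k}(t)=-A\widehat{\bf y}_{\ell,k}(t)-\tfrac{\ell}{t}\widehat{\bf y}_{\ell,k}(t)+\tfrac{1}{t(\ell-1)!}{\bf v}-\widehat{\bf y}_{\ell,k}'(t).$$ Let ${\bf g}=\gamma h_{k+1,k}^{2}(I+\gamma H_{k})^{-\mathrm{H}}{\bf e}_{k}$. Then $$ \widehat{\bf y}_{\ell,k}(t)-{\bf y}_{\ell,k}(t)=V_{k}\Big[(-tH_{k})^{-\ell}\beta\sum_{m=2}^{\infty}\frac{(-t)^{m}}{m!}\sum_{p=1}^{m-1}[{\bf e}_{k}^{\mathrm{H}}T_{k}^{p}{\bf e}_{1}][H_{k}^{m-1-p}{\bf g}]-\sum_{j=1}^{\ell}[{\bf e}_{k}^{\mathrm{H}}\varphi_{j}(-tT_{k})\beta{\bf e}_{1}](-tH_{k})^{-\ell+j}[H_{k}^{-1}{\bf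 g}]\Big] $$ and $$ \widehat{\bf r}_{\ell,k}(t)={\bf r}_{\ell,k}(t)-(h_{k+1,k}\varrho){\bf v}_{k+1}+\gamma h_{k+1,k}^{2}\big[{\bf e}_{k}^{\mathrm{H}}\varphi_{\ell}(-tH_{k})\beta{\bf e}_{1}+\varrho\big]V_{k}(I+\gamma H_{k})^{-\mathrm{H}}{\bf e}_{k}, $$ where $$ \varrho=\frac{\beta}{(\ell-1)!}\int_0^1\sum_{m=2}^{\infty}\frac{t^{m}(\theta-1)^{m}}{m!}\sum_{p=1}^{m-1}\big[{\bf e}_{k}^{\mathrm{H}}T_{k}^{p}{\bf e}_{1}\big]\big[{\bf e}_{k}^{\mathrm{H}}H_{k}^{m-1-p}{\bf g}\big]\theta^{\ell-1}\,d\theta. $$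
   Context: The $\varphi$-functions are $\varphi_0(z)=e^z$ and $\varphi_\ell(z)=\frac{1}{(\ell-1)!}\int_0^1 e^{(1-\theta)z}\theta^{\ell-1}d\theta$ for $\ell\ge1$, $z\in\mathbb C$ (entire functions, extended to square matrices as matrix functions). $A$ is an $n\times n$ matrix, $t>0$, the spectrum of $-tA$ lies in the (closed) left half plane, and ${\bf v}$ is a nonzero vector with $\beta=\|{\bf v}\|_2$. The $k$-step Arnoldi process started with ${\bf v}_1={\bf v}/\beta$ is assumed to produce $V_{k+1}=[{\bf v}_1,\dots,{\bf v}_{k+1}]=[V_k,{\bf v}_{k+1}]$ with orthonormal columns (spanning the Krylov subspace $\mathrm{span}\{{\bf v}_1,A{\bf v}_1,\dots,A^k{\bf v}_1\}$), a $k\times k$ upper Hessenberg matrix $H_k$ and a real scalar $h_{k+1,k}$ with $$AV_k=V_kH_k+h_{k+1,k}{\bf v}_{k+1}{\bf e}_k^{\mathrm{H}}.$$ Here ${\bf e}_j$ is the $j$-th column of the $k\times k$ identity matrix, $(\cdot)^{\mathrm{H}}$ is the conjugate transpose, $(\cdot)^{-\mathrm{H}}$ is the inverse of the conjugate transpose, and $'$ denotes $d/dt$. The parameter $\gamma$ is a nonzero real number such that $I+\gamma H_k$ is nonsingular, and $$T_k=H_k+\gamma h_{k+1,k}^2(I+\gamma H_k)^{-\mathrm{H}}{\bf e}_k{\bf e}_k^{\mathrm{H}}.$$ *)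

theory Defs
  imports "HOL-Analysis.Analysis"
begin

definition phi :: "nat \<Rightarrow> complex \<Rightarrow> complex" where
  "phi l z =
     (if l = 0 then exp z
      else (1 / fact (l - 1)) *
        integral {0..1} (\<lambda>\<theta>::real. exp ((1 - of_real \<theta>) * z) * of_real \<theta> ^ (l - 1)))"

primrec matpow :: "'a::semiring_1^'n^'n \<Rightarrow> nat \<Rightarrow> 'a^'n^'n" where
  "matpow M 0 = mat 1"
| "matpow M (Suc m) = M ** matpow M m"

definition matpowi :: "'a::semiring_1^'n^'n \<Rightarrow> int \<Rightarrow> 'a^'n^'n" where
  "matpowi M z =
     (if z \<ge> 0 then matpow M (nat z) else matpow (matrix_inv M) (nat (- z)))"

text \<open>The matrix function of an entire \<open>f\<close>, by its Taylor series at \<open>0\<close>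
  (which converges at every matrix).\<close>

definition matfun :: "(complex \<Rightarrow> complex) \<Rightarrow> complex^'n^'n \<Rightarrow> complex^'n^'n" where
  "matfun f M = (\<Sum>m. map_matrix (\<lambda>x. ((deriv ^^ m) f 0 / fact m) * x) (matpow M m))"

definition conj_transpose :: "complex^'n^'m \<Rightarrow> complex^'m^'n" where
  "conj_transpose M = (\<chi> i j. cnj (M $ j $ i))"

text \<open>\<open>cdot u w\<close> is $u^{\mathrm{H}} w$ and \<open>couter u w\<close> is $u w^{\mathrm{H}}$.\<close>

definition cdot :: "complex^'n \<Rightarrow> complex^'n \<Rightarrow> complex" where
  "cdot u w = (\<Sum>i\<in>UNIV. cnj (u $ i) * w $ i)"

definition couter :: "complex^'m \<Rightarrow> complex^'n \<Rightarrow> complex^'n^'m" where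
  "couter u w = (\<chi> i j. u $ i * cnj (w $ j))"

definition mat_spectrum :: "complex^'n^'n \<Rightarrow> complex set" where
  "mat_spectrum M = {\<mu>. \<exists>x. x \<noteq> 0 \<and> M *v x = \<mu> *s x}"

text \<open>The indices \<open>1, \<dots>, k\<close> are the elements of a finite linearly ordered type, in
  increasing order, so the first index is the minimum and the last index the maximum of the type.\<close>

definition first_idx :: "'k::{finite,linorder}" where
  "first_idx = Min UNIV"

definition last_idx :: "'k::{finite,linorder}" where
  "last_idx = Max UNIV"

text \<open>All entries below the first subdiagonal vanish: \<open>i > j + 1\<close> means that some index
  lies strictly between \<open>j\<close> and \<open>i\<close>.\<close>

definition upper_hessenberg :: "complex^'k::{finite,linorder}^'k::{finite,linorder} \<Rightarrow> bool" where
  "upper_hessenberg H \<longleftrightarrow> (\<forall>i j. (\<exists>p. j < p \<and> p < i) \<longrightarrow> H $ i $ j = 0)"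

text \<open>\<open>append_col V w\<close> is $[V, w]$; the additional last column has index \<open>None\<close>.\<close>

definition append_col :: "complex^'k^'n \<Rightarrow> complex^'n \<Rightarrow> complex^('k option)^'n" where
  "append_col V w = (\<chi> i j. case j of None \<Rightarrow> w $ i | Some p \<Rightarrow> V $ i $ p)"

text \<open>Output of the \<open>k\<close>-step Arnoldi process for \<open>A\<close> started with \<open>v / \<parallel>v\<parallel>\<close>, where \<open>k\<close> is
  \<open>CARD('k)\<close>: \<open>V\<close> is $V_k$, \<open>w\<close> is $v_{k+1}$ and \<open>h\<close> is $h_{k+1,k}$.
  On complex vectors \<open>norm\<close> is the Euclidean norm, and \<open>vec.span\<close> is the complex span.\<close>

definition arnoldi ::
  "complex^'n^'n \<Rightarrow> complex^'n \<Rightarrow> complex^'k::{finite,linorder}^'n \<Rightarrow> complex^'n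
    \<Rightarrow> complex^'k::{finite,linorder}^'k::{finite,linorder} \<Rightarrow> real \<Rightarrow> bool" where
  "arnoldi A v V w H h \<longleftrightarrow>
     column first_idx V = v /\<^sub>R norm v \<and>
     conj_transpose (append_col V w) ** append_col V w = mat 1 \<and>
     vec.span (columns (append_col V w)) =
       vec.span {matpow A i *v (v /\<^sub>R norm v) | i. i \<le> CARD('k)} \<and>
     upper_hessenberg H \<and>
     A ** V = V ** H + h *\<^sub>R couter w (axis last_idx 1)"

definition residual ::
  "nat \<Rightarrow> complex^'n^'n \<Rightarrow> complex^'n \<Rightarrow> (real \<Rightarrow> complex^'n) \<Rightarrow> real \<Rightarrow> complex^'n" where
  "residual l A v y t =
     - (A *v y t) - (real l / t) *\<^sub>R y t + (1 / (t * fact (l - 1))) *\<^sub>R v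
       - vector_derivative y (at t)"

end

theory Submission
  imports Defs
begin

text \<open>The harmonic matrix is the rank-one perturbation \<open>T = H + g e\<^sub>k\<^sup>H\<close> of \<open>H\<close>.
  Telescoping gives \<open>T\<^sup>m e\<^sub>1 - H\<^sup>m e\<^sub>1 = (\<Sum>p<m. (e\<^sub>k\<^sup>H T\<^sup>p e\<^sub>1) H\<^bsup>m - 1 - p\<^esup> g)\<close>,
  whose \<open>p = 0\<close> term vanishes as \<open>k \<ge> 2\<close>; summing against the exponential series
  yields the difference for \<open>\<phi>\<^sub>0\<close>. The recurrence
  \<open>z \<phi>\<^bsub>l+1\<^esub>(z) = \<phi>\<^sub>l(z) - 1/l!\<close>, applied to \<open>- t T\<close> and to \<open>- t H\<close>, propagates it to
  \<open>\<phi>\<^sub>l\<close> by induction, which is the first identity.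
  The same recurrence together with \<open>z \<phi>\<^sub>l'(z) = \<phi>\<^bsub>l-1\<^esub>(z) - l \<phi>\<^sub>l(z)\<close> shows that every
  \<open>y(t) = V \<phi>\<^sub>l(- t K) \<beta> e\<^sub>1\<close> has residual \<open>(V K - A V) \<phi>\<^sub>l(- t K) \<beta> e\<^sub>1\<close>; for \<open>K = H\<close> and
  \<open>K = T\<close> the Arnoldi relation makes \<open>V K - A V\<close> of rank at most two, and \<open>\<rho>\<close> is
  \<open>e\<^sub>k\<^sup>H (\<phi>\<^sub>l(- t T) - \<phi>\<^sub>l(- t H)) \<beta> e\<^sub>1\<close>, by termwise integration of the series against
  \<open>(\<integral>\<^sub>0\<^sup>1 (1 - \<theta>)\<^sup>m \<theta>\<^sup>n d\<theta>) = m! n! / (m + n + 1)!\<close>.\<close>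

section \<open>Power series of the \<open>\<phi>\<close>-functions\<close>

text \<open>The Beta integral at integer arguments. Integration by parts trades a factor
  \<open>1 - \<theta>\<close> for a factor \<open>\<theta>\<close>, so the induction on
  \<open>m\<close> needs \<open>n\<close> arbitrary.\<close>

lemma has_integral_beta_nat:
  "((\<lambda>\<theta>::real. (1 - \<theta>) ^ m * \<theta> ^ n) has_integral fact m * fact n / fact (m + n + 1)) {0..1}"
proof (induction m arbitrary: n)
  case 0
  have "((\<lambda>\<theta>::real. \<theta> ^ n) has_integral 1 ^ Suc n / real (Suc n) - 0 ^ Suc n / real (Suc n)) {0..1}"
    using DERIV_cdivide[OF DERIV_pow[of "Suc n"], of "real (Suc n)"]
    by (intro fundamental_theorem_of_calculus)
       (auto simp flip: has_real_derivative_iff_has_vector_derivative simp del: of_nat_Suc power_Suc)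
  moreover have "fact 0 * fact n / fact (0 + n + 1) = 1 / (1 + real n)"
    by (simp add: divide_simps)
  ultimately show ?case
    by simp
next
  case (Suc m)
  \<comment> \<open>The integrated term of the integration by parts; it vanishes at both ends of the
    interval, which leaves only \<open>?c\<close> times the integral for \<open>m\<close> and
    \<open>Suc n\<close>.\<close>
  let ?F = "\<lambda>\<theta>::real. (1 - \<theta>) ^ Suc m * \<theta> ^ Suc n / real (Suc n)"
  let ?c = "real (Suc m) / real (Suc n)"
  have nz: "1 + real n \<noteq> 0"
    by linarith
  have "(?F has_real_derivative (1 - x) ^ Suc m * x ^ n - ?c * ((1 - x) ^ m * x ^ Suc n)) (at x within S)"
    for x S
    by (rule derivative_eq_intros refl | simp)+ (simp add: nz field_simps)
  then have "((\<lambda>\<theta>::real. (1 - \<theta>) ^ Suc m * \<theta> ^ n - ?c * ((1 - \<theta>) ^ m * \<theta> ^ Suc n))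
          has_integral ?F 1 - ?F 0) {0..1}"
    by (intro fundamental_theorem_of_calculus)
       (auto simp flip: has_real_derivative_iff_has_vector_derivative)
  from has_integral_add[OF this has_integral_mult_right[OF Suc.IH[of "Suc n"], of ?c]]
  have "((\<lambda>\<theta>::real. (1 - \<theta>) ^ Suc m * \<theta> ^ n) has_integral
      ?F 1 - ?F 0 + ?c * (fact m * fact (Suc n) / fact (m + Suc n + 1))) {0..1}"
    by (simp only: diff_add_cancel)
  also have "?F 1 - ?F 0 + ?c * (fact m * fact (Suc n) / fact (m + Suc n + 1))
      = (fact (Suc m) * fact n / fact (Suc m + n + 1) :: real)"
    by (simp add: nz)
  finally show ?case .
qed

text \<open>On the unit interval the weights are at most \<open>1 / fact m\<close>, so the
  Weierstrass M-test gives uniform convergence and integration may be done termwise. It serves both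
  \<open>phi\<close> itself, with \<open>a m = z ^ m\<close>, and the integral in
  \<open>\<rho>\<close>.\<close>

lemma has_integral_beta_series:
  fixes a :: "nat \<Rightarrow> 'a::banach"
  assumes "summable (\<lambda>m. norm (a m) / fact m)"
  shows "((\<lambda>\<theta>::real. \<Sum>m. ((1 - \<theta>) ^ m * \<theta> ^ n / fact m) *\<^sub>R a m)
           has_integral (\<Sum>m. (fact n / fact (m + n + 1)) *\<^sub>R a m)) {0..1}"
proof -
  let ?f = "\<lambda>m \<theta>::real. ((1 - \<theta>) ^ m * \<theta> ^ n / fact m) *\<^sub>R a m"
  have bd: "norm (?f m \<theta>) \<le> norm (a m) / fact m" if "\<theta> \<in> {0..1}" for m \<theta>
  proof -
    have "\<bar>(1 - \<theta>) ^ m * \<theta> ^ n\<bar> \<le> 1"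
      using that by (auto simp: abs_mult power_abs intro!: mult_le_one power_le_one)
    then have "\<bar>(1 - \<theta>) ^ m * \<theta> ^ n\<bar> * (norm (a m) / fact m) \<le> 1 * (norm (a m) / fact m)"
      by (intro mult_right_mono) auto
    then show ?thesis by (simp add: abs_mult)
  qed
  have ul: "uniform_limit {0..1} (\<lambda>N \<theta>. \<Sum>m<N. ?f m \<theta>) (\<lambda>\<theta>. \<Sum>m. ?f m \<theta>) sequentially"
    by (rule Weierstrass_m_test[OF bd assms])
  have cont: "continuous_on {0..1} (\<lambda>\<theta>. \<Sum>m<N. ?f m \<theta>)" for N
    by (intro continuous_intros) auto
  obtain I J where I: "\<And>N. ((\<lambda>\<theta>. \<Sum>m<N. ?f m \<theta>) has_integral I N) {0..1}"
    and J: "((\<lambda>\<theta>. \<Sum>m. ?f m \<theta>) has_integral J) {0..1}" and IJ: "I \<longlonglongrightarrow> J"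
    using uniform_limit_integral[OF ul cont] by auto
  have *: "(?f m has_integral (fact n / fact (m + n + 1)) *\<^sub>R a m) {0..1}" for m
    using has_integral_scaleR_left[OF has_integral_divide[OF has_integral_beta_nat[of m n], of "fact m"], of "a m"]
    by simp
  have "I = (\<lambda>N. \<Sum>m<N. (fact n / fact (m + n + 1)) *\<^sub>R a m)"
    by (rule ext, rule has_integral_unique[OF I has_integral_sum[OF finite_lessThan *]])
  with IJ have "(\<lambda>m. (fact n / fact (m + n + 1)) *\<^sub>R a m) sums J"
    by (simp only: sums_def)
  with J show ?thesis by (simp add: sums_iff)
qed

lemma summable_power_div_fact_add:
  fixes K :: real shows "summable (\<lambda>m. K ^ m / fact (m + l))"
proof (rule summable_comparison_test[OF exI[of _ 0]])
  show "summable (\<lambda>m. \<bar>K\<bar> ^ m / fact m)"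
    using summable_exp[of "\<bar>K\<bar>"] by (simp add: field_simps)
  show "\<forall>m\<ge>0. norm (K ^ m / fact (m + l)) \<le> \<bar>K\<bar> ^ m / fact m"
    by (auto simp: abs_mult power_abs intro!: divide_left_mono fact_mono)
qed

text \<open>Expanding the exponential under the integral sign and integrating termwise produces
  \<open>fact (l - 1)\<close>, which cancels the prefactor of \<open>phi\<close>. The case
  \<open>l = 0\<close> is the exponential series.\<close>

lemma phi_sums: "(\<lambda>m. z ^ m / fact (m + l)) sums phi l z"
proof -
  have sm: "summable (\<lambda>m. norm (z ^ m / fact (m + l)))"
    using summable_power_div_fact_add[of "norm z" l] by (simp add: norm_divide norm_power)
  show ?thesis
  proof (cases l)
    case 0
    then show ?thesis
      using exp_converges[of z] by (simp add: phi_def scaleR_conv_of_real field_simps)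
  next
    case (Suc n)
    let ?g = "\<lambda>\<theta>::real. exp ((1 - of_real \<theta>) * z) * of_real \<theta> ^ n"
    have s: "(\<Sum>m. ((1 - \<theta>) ^ m * \<theta> ^ n / fact m) *\<^sub>R z ^ m) = ?g \<theta>" for \<theta> :: real
    proof -
      have "(\<lambda>m. of_real \<theta> ^ n * (((1 - of_real \<theta>) * z) ^ m /\<^sub>R fact m)) sums (of_real \<theta> ^ n * exp ((1 - of_real \<theta>) * z))"
        by (intro sums_mult exp_converges)
      also have "(\<lambda>m. of_real \<theta> ^ n * (((1 - of_real \<theta>) * z) ^ m /\<^sub>R fact m))
         = (\<lambda>m. ((1 - \<theta>) ^ m * \<theta> ^ n / fact m) *\<^sub>R z ^ m)"
        by (simp add: scaleR_conv_of_real power_mult_distrib divide_inverse mult_ac)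
      finally show ?thesis by (simp add: sums_iff mult.commute)
    qed
    have "summable (\<lambda>m. norm (z ^ m) / fact m)"
      using summable_power_div_fact_add[of "norm z" 0] by (simp add: norm_power)
    from has_integral_beta_series[OF this, of n]
    have "integral {0..1} ?g = (\<Sum>m. (fact n / fact (m + n + 1)) *\<^sub>R z ^ m)"
      unfolding s by (rule integral_unique)
    also have "\<dots> = (\<Sum>m. fact n * (z ^ m / fact (m + l)))"
      by (simp add: Suc scaleR_conv_of_real)
    also have "\<dots> = fact n * (\<Sum>m. z ^ m / fact (m + l))"
      using sm by (intro suminf_mult) (rule summable_norm_cancel)
    finally have "phi l z = (\<Sum>m. z ^ m / fact (m + l))"
      by (simp add: phi_def Suc)
    then show ?thesis
      using sm by (simp add: summable_norm_cancel summable_sums)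
  qed
qed

text \<open>\<open>matfun\<close> refers to iterated derivatives at 0. The series of
  \<open>phi l\<close> converges at every positive radius, so it is the power series expansion at 0
  and its coefficients are the Taylor coefficients.\<close>

lemma phi_taylor_coeff: "(deriv ^^ m) (phi l) 0 / fact m = 1 / fact (m + l)"
proof -
  let ?F = "Abs_fps (\<lambda>m. 1 / fact (m + l)) :: complex fps"
  have e: "eval_fps ?F = phi l"
    using phi_sums[of _ l] by (auto simp: eval_fps_def fun_eq_iff sums_iff)
  have "fps_conv_radius ?F \<ge> \<infinity>"
    unfolding fps_conv_radius_def
  proof (rule conv_radius_geI_ex')
    fix r :: real
    assume "r > 0"
    show "summable (\<lambda>n. fps_nth ?F n * of_real r ^ n)"
      using phi_sums[of "of_real r" l] by (simp add: sums_iff)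
  qed
  then have "fps_conv_radius ?F > 0" by simp
  from fps_nth_fps_expansion[OF eval_fps_has_fps_expansion[OF this], of m] show ?thesis
    by (simp add: e)
qed

section \<open>\<open>\<phi>\<close>-functions of matrices\<close>

text \<open>Bounded bilinearity is what lets infinite sums and derivatives pass through matrix
  products.\<close>

lemma bounded_bilinear_matrix_matrix_mult:
  "bounded_bilinear ((**) :: complex^'m^'n \<Rightarrow> complex^'p^'m \<Rightarrow> complex^'p^'n)"
  by (simp add: bilinear_def linear_iff matrix_add_ldistrib vec_eq_iff matrix_matrix_mult_def
      sum.distrib distrib_right distrib_left scaleR_right.sum
      flip: bilinear_conv_bounded_bilinear)

lemma bounded_bilinear_matrix_vector_mult:
  "bounded_bilinear ((*v) :: complex^'m^'n \<Rightarrow> complex^'m \<Rightarrow> complex^'n)"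
  by (simp add: bilinear_def linear_iff vec_eq_iff matrix_vector_mult_def
      sum.distrib distrib_right distrib_left scaleR_right.sum
      flip: bilinear_conv_bounded_bilinear)

lemmas bounded_linear_matrix_mult_right =
  bounded_bilinear.bounded_linear_right[OF bounded_bilinear_matrix_matrix_mult]

lemmas bounded_linear_matrix_vector_left =
  bounded_bilinear.bounded_linear_left[OF bounded_bilinear_matrix_vector_mult]

lemma scaleR_matrix_vector: "(s *\<^sub>R M) *v x = s *\<^sub>R (M *v x)" for M :: "complex^'m^'n"
  by (rule bounded_bilinear.scaleR_left[OF bounded_bilinear_matrix_vector_mult])

lemma matrix_vector_scaleR: "M *v (s *\<^sub>R x) = s *\<^sub>R (M *v x)" for M :: "complex^'m^'n"
  by (rule bounded_bilinear.scaleR_right[OF bounded_bilinear_matrix_vector_mult])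

lemma matrix_vector_mult_smult: "M *v (c *s x) = c *s (M *v x)" for M :: "complex^'m^'n"
  by (simp add: vec_eq_iff matrix_vector_mult_def sum_distrib_left mult_ac)

lemma matpow_scaleR: "matpow (s *\<^sub>R M) m = s ^ m *\<^sub>R matpow M m" for M :: "complex^'n^'n"
  by (induction m)
     (simp_all add: bounded_bilinear.scaleR_left[OF bounded_bilinear_matrix_matrix_mult]
        bounded_bilinear.scaleR_right[OF bounded_bilinear_matrix_matrix_mult])

text \<open>The bound for \<open>**\<close> as a bilinear map supplies a constant that stands in for
  submultiplicativity of the norm.\<close>

lemma norm_matpow_bound:
  fixes M :: "complex^'n^'n"
  obtains C K where "\<And>m. norm (matpow M m) \<le> C * K ^ m"
proof -
  obtain K where K: "K > 0"
    "\<And>(X :: complex^'n^'n) (Y :: complex^'n^'n). norm (X ** Y) \<le> norm X * norm Y * K"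
    using bounded_bilinear.pos_bounded[OF bounded_bilinear_matrix_matrix_mult] by metis
  have "norm (matpow M m) \<le> norm (mat 1 :: complex^'n^'n) * (norm M * K) ^ m" for m
  proof (induction m)
    case (Suc m)
    have "norm (matpow M (Suc m)) \<le> norm M * norm (matpow M m) * K"
      using K by simp
    also have "\<dots> \<le> norm M * (norm (mat 1 :: complex^'n^'n) * (norm M * K) ^ m) * K"
      using K Suc by (intro mult_right_mono mult_left_mono) auto
    finally show ?case by (simp add: mult_ac)
  qed simp
  then show ?thesis by (rule that)
qed

lemma summable_norm_matpow:
  fixes M :: "complex^'n^'n"
  shows "summable (\<lambda>m. norm ((s ^ m / fact (m + l)) *\<^sub>R matpow M m))"
proof -
  obtain C K where K: "\<And>m. norm (matpow M m) \<le> C * K ^ m"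
    using norm_matpow_bound[of M] by blast
  show ?thesis
  proof (rule summable_comparison_test[OF exI[of _ 0]])
    show "summable (\<lambda>m. C * ((\<bar>s\<bar> * K) ^ m / fact (m + l)))"
      by (intro summable_mult summable_power_div_fact_add)
    show "\<forall>m\<ge>0. norm (norm ((s ^ m / fact (m + l)) *\<^sub>R matpow M m))
        \<le> C * ((\<bar>s\<bar> * K) ^ m / fact (m + l))"
    proof (intro allI impI)
      fix m
      have "\<bar>s\<bar> ^ m / fact (m + l) * norm (matpow M m) \<le> \<bar>s\<bar> ^ m / fact (m + l) * (C * K ^ m)"
        by (intro mult_left_mono K) auto
      then show "norm (norm ((s ^ m / fact (m + l)) *\<^sub>R matpow M m))
        \<le> C * ((\<bar>s\<bar> * K) ^ m / fact (m + l))"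
        by (simp add: power_mult_distrib power_abs mult_ac)
    qed
  qed
qed

text \<open>The real factor \<open>s\<close> is kept apart from \<open>M\<close>, so that the matrix
  function becomes a power series in \<open>s\<close> with fixed matrix coefficients, ready to be
  differentiated in \<open>s\<close>.\<close>

lemma matfun_phi_sums:
  fixes M :: "complex^'n^'n"
  shows "(\<lambda>m. (s ^ m / fact (m + l)) *\<^sub>R matpow M m) sums matfun (phi l) (s *\<^sub>R M)"
proof -
  have "map_matrix (\<lambda>x. ((deriv ^^ m) (phi l) 0 / fact m) * x) (matpow (s *\<^sub>R M) m)
      = (s ^ m / fact (m + l)) *\<^sub>R matpow M m" for m
    unfolding phi_taylor_coeff by (simp add: vec_eq_iff matpow_scaleR scaleR_conv_of_real[where 'a = complex])
  then show ?thesis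
    using summable_sums[OF summable_norm_cancel[OF summable_norm_matpow[of s l M]]]
    by (simp add: matfun_def)
qed

lemma matfun_phi_mult_sums:
  fixes M :: "complex^'n^'n"
  shows "(\<lambda>m. (s ^ m / fact (m + l)) *\<^sub>R (matpow M m *v x)) sums (matfun (phi l) (s *\<^sub>R M) *v x)"
  using bounded_linear.sums[OF bounded_linear_matrix_vector_left[of x] matfun_phi_sums[of s l M]]
  by (simp add: scaleR_matrix_vector)

text \<open>Multiplication by \<open>M\<close> shifts the series of \<open>phi (Suc l)\<close> by
  one index, giving the series of \<open>phi l\<close> without its constant term.\<close>

lemma matfun_phi_Suc:
  fixes M :: "complex^'n^'n"
  shows "M ** matfun (phi (Suc l)) M = matfun (phi l) M - (1 / fact l) *\<^sub>R mat 1"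
proof -
  have "(\<lambda>m. (1 / fact (Suc m + l)) *\<^sub>R matpow M (Suc m))
          sums (matfun (phi l) M - (1 / fact l) *\<^sub>R mat 1)"
    using matfun_phi_sums[of 1 l M]
    by (subst sums_Suc_iff[of "\<lambda>m. (1 / fact (m + l)) *\<^sub>R matpow M m"]) simp
  moreover have "(\<lambda>m. (1 / fact (Suc m + l)) *\<^sub>R matpow M (Suc m))
          sums (M ** matfun (phi (Suc l)) M)"
    using bounded_linear.sums[OF bounded_linear_matrix_mult_right[of M] matfun_phi_sums[of 1 "Suc l" M]]
    by (simp add: bounded_bilinear.scaleR_right[OF bounded_bilinear_matrix_matrix_mult])
  ultimately show ?thesis by (rule sums_unique2[symmetric])
qed

text \<open>Taking the inner product with each basis vector reduces the claim to termwise
  differentiation of an everywhere convergent real power series.\<close>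

lemma has_vector_derivative_powser:
  fixes a :: "nat \<Rightarrow> 'a::euclidean_space" and f :: "real \<Rightarrow> 'a"
  assumes f: "\<And>s. (\<lambda>m. s ^ m *\<^sub>R a m) sums f s"
    and D: "(\<lambda>m. (real (Suc m) * s ^ m) *\<^sub>R a (Suc m)) sums D"
  shows "(f has_vector_derivative D) (at s)"
  unfolding has_vector_derivative_def
proof (subst has_derivative_componentwise_within, intro ballI)
  fix b :: 'a assume "b \<in> Basis"
  have fb: "(\<lambda>m. (a m \<bullet> b) * s ^ m) sums (f s \<bullet> b)" for s
    using bounded_linear.sums[OF bounded_linear_inner_left[of b] f[of s]] by (simp add: mult_ac)
  have Db: "(\<lambda>m. diffs (\<lambda>m. a m \<bullet> b) m * s ^ m) sums (D \<bullet> b)"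
    using bounded_linear.sums[OF bounded_linear_inner_left[of b] D]
    by (simp add: diffs_def mult_ac del: of_nat_Suc)
  have "((\<lambda>s. \<Sum>m. (a m \<bullet> b) * s ^ m) has_real_derivative
          (\<Sum>m. diffs (\<lambda>m. a m \<bullet> b) m * s ^ m)) (at s)"
    using fb by (intro termdiffs_strong_converges_everywhere) (auto simp: sums_iff)
  moreover have "(\<lambda>s. \<Sum>m. (a m \<bullet> b) * s ^ m) = (\<lambda>s. f s \<bullet> b)"
    using fb by (auto simp: sums_iff)
  moreover have "(\<Sum>m. diffs (\<lambda>m. a m \<bullet> b) m * s ^ m) = D \<bullet> b"
    using Db by (simp add: sums_iff)
  ultimately show "((\<lambda>s. f s \<bullet> b) has_derivative (\<lambda>x. (x *\<^sub>R D) \<bullet> b)) (at s)"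
    by (simp add: has_field_derivative_def mult_commute_abs)
qed

lemma matfun_phi_has_vector_derivative:
  fixes M :: "complex^'n^'n"
  assumes "s \<noteq> 0"
  shows "((\<lambda>s. matfun (phi (Suc n)) (s *\<^sub>R M)) has_vector_derivative
           (1 / s) *\<^sub>R (matfun (phi n) (s *\<^sub>R M) - real (Suc n) *\<^sub>R matfun (phi (Suc n)) (s *\<^sub>R M))) (at s)"
proof (rule has_vector_derivative_powser)
  let ?a = "\<lambda>m. (1 / fact (m + Suc n)) *\<^sub>R matpow M m"
  show "(\<lambda>m. s ^ m *\<^sub>R ?a m) sums matfun (phi (Suc n)) (s *\<^sub>R M)" for s
    using matfun_phi_sums[of s "Suc n" M] by simp
  let ?d = "matfun (phi n) (s *\<^sub>R M) - real (Suc n) *\<^sub>R matfun (phi (Suc n)) (s *\<^sub>R M)"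
  have "(\<lambda>m. (s ^ m / fact (m + n)) *\<^sub>R matpow M m
            - real (Suc n) *\<^sub>R ((s ^ m / fact (m + Suc n)) *\<^sub>R matpow M m)) sums ?d"
    by (intro sums_diff sums_scaleR_right matfun_phi_sums)
  \<comment> \<open>Since \<open>fact (m + Suc n)\<close> is \<open>m + Suc n\<close> times
    \<open>fact (m + n)\<close>, the difference of coefficients leaves exactly the factor
    \<open>m\<close> that \<open>s * d/ds\<close> produces.\<close>
  moreover have "(s ^ m / fact (m + n)) *\<^sub>R matpow M m
            - real (Suc n) *\<^sub>R ((s ^ m / fact (m + Suc n)) *\<^sub>R matpow M m)
          = (real m * s ^ m) *\<^sub>R ?a m" for m
  proof -
    have alg: "q / F - N * (q / ((x + N) * F)) = x * q / ((x + N) * F)"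
      if "x + N \<noteq> 0" "F \<noteq> 0" for q F N x :: real
      using that by (simp add: divide_simps) (simp add: algebra_simps)
    have "fact (m + Suc n) = (real m + real (Suc n)) * fact (m + n)"
      by (simp add: algebra_simps)
    then have "s ^ m / fact (m + n) - real (Suc n) * (s ^ m / fact (m + Suc n))
        = real m * s ^ m / fact (m + Suc n)"
      using alg[of "real m" "real (Suc n)" "fact (m + n)" "s ^ m"] by (simp add: add_ac)
    then show ?thesis
      by (simp add: scaleR_diff_left[symmetric] del: of_nat_Suc fact_Suc add_Suc_right)
  qed
  ultimately have "(\<lambda>m. (real m * s ^ m) *\<^sub>R ?a m) sums ?d"
    by simp
  \<comment> \<open>The term at \<open>m = 0\<close> vanishes, so the series may start at 1; one
    factor \<open>s\<close> is then divided out.\<close>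
  then have "(\<lambda>m. (real (Suc m) * s ^ Suc m) *\<^sub>R ?a (Suc m)) sums ?d"
    by (subst sums_Suc_iff[of "\<lambda>m. (real m * s ^ m) *\<^sub>R ?a m"]) simp
  from sums_scaleR_right[OF this, of "1 / s"]
  show "(\<lambda>m. (real (Suc m) * s ^ m) *\<^sub>R ?a (Suc m)) sums ((1 / s) *\<^sub>R ?d)"
    using assms by (simp del: of_nat_Suc fact_Suc add_Suc_right add_Suc matpow.simps)
qed

text \<open>Bridges ordered series over all naturals and the unordered sums from 2 in the theorem:
  absolute convergence makes the order irrelevant, and the first two terms are zero.\<close>

lemma has_sum_from_2:
  fixes f :: "nat \<Rightarrow> 'a::banach"
  assumes "summable (\<lambda>m. norm (f m))" "f sums S" "f 0 = 0" "f 1 = 0"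
  shows "(f has_sum S) {2..}"
proof -
  have "f m = 0" if "m < 2" for m
    using that assms(3,4) by (auto simp: less_2_cases_iff)
  then show ?thesis
    using norm_summable_imp_has_sum[OF assms(1,2)]
    by (subst has_sum_cong_neutral[where T = UNIV and g = f]) auto
qed

section \<open>Matrix inverses and rank-one matrices\<close>

lemma matrix_inv_invertible:
  assumes "invertible M"
  shows "M ** matrix_inv M = mat 1" "matrix_inv M ** M = mat 1"
proof -
  have "M ** matrix_inv M = mat 1 \<and> matrix_inv M ** M = mat 1"
    using assms unfolding invertible_def matrix_inv_def by (rule someI_ex)
  then show "M ** matrix_inv M = mat 1" "matrix_inv M ** M = mat 1" by auto
qed

lemma couter_mult_vec: "couter u w *v x = cdot w x *s u"
  by (simp add: vec_eq_iff couter_def cdot_def matrix_vector_mult_def sum_distrib_left sum_distrib_right mult_ac)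

lemma matrix_mult_couter: "X ** couter u w = couter (X *v u) w"
  by (simp add: vec_eq_iff couter_def matrix_matrix_mult_def matrix_vector_mult_def sum_distrib_left mult_ac)

lemma couter_scaleR_left: "couter (c *\<^sub>R u) w = c *\<^sub>R couter u w"
  by (simp add: vec_eq_iff couter_def)

lemma cdot_axis: "cdot (axis i 1) x = x $ i"
proof -
  have "cdot (axis i 1) x = (\<Sum>j\<in>UNIV. if j = i then x $ j else 0)"
    unfolding cdot_def by (intro sum.cong) (auto simp: axis_def)
  then show ?thesis by simp
qed

section \<open>Derivative and residual of a Krylov approximation\<close>

lemma has_vector_derivative_matfun_phi_mult:
  fixes K :: "complex^'k^'k" and V :: "complex^'k^'n"
  assumes "l \<ge> 1" "t \<noteq> 0"
  shows "((\<lambda>s. V *v (matfun (phi l) ((- s) *\<^sub>R K) *v x)) has_vector_derivative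
     - (V *v (K *v (matfun (phi l) ((- t) *\<^sub>R K) *v x)))
     - (real l / t) *\<^sub>R (V *v (matfun (phi l) ((- t) *\<^sub>R K) *v x))
     + (1 / (t * fact (l - 1))) *\<^sub>R (V *v x)) (at t)"
proof -
  obtain n where n: "l = Suc n" using assms by (cases l) auto
  \<comment> \<open>The minus sign is moved to \<open>K\<close>, so that the derivative lemma
    applies with \<open>M = - K\<close> and positive parameter \<open>s\<close>.\<close>
  let ?P = "\<lambda>l s. matfun (phi l) (s *\<^sub>R (- K))"
  have "((\<lambda>s. V *v (?P l s *v x)) has_vector_derivative
     V *v (((1 / t) *\<^sub>R (?P n t - real l *\<^sub>R ?P l t)) *v x)) (at t)"
    unfolding n using assms
    by (intro bounded_linear.has_vector_derivative[OF matrix_vector_mul_bounded_linear]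
        bounded_linear.has_vector_derivative[OF bounded_linear_matrix_vector_left]
        matfun_phi_has_vector_derivative)
  moreover have "?P n t = (t *\<^sub>R (- K)) ** ?P l t + (1 / fact n) *\<^sub>R mat 1"
    using matfun_phi_Suc[of "t *\<^sub>R (- K)" n] by (simp add: n)
  then have Pn: "?P n t *v x = - t *\<^sub>R (K *v (?P l t *v x)) + (1 / fact n) *\<^sub>R x"
    by (simp add: matrix_vector_mult_add_rdistrib scaleR_matrix_vector matrix_vector_mul_assoc[symmetric]
       bounded_bilinear.minus_left[OF bounded_bilinear_matrix_vector_mult])
  then have "V *v (((1 / t) *\<^sub>R (?P n t - real l *\<^sub>R ?P l t)) *v x)
     = - (V *v (K *v (?P l t *v x))) - (real l / t) *\<^sub>R (V *v (?P l t *v x))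
     + (1 / (t * fact n)) *\<^sub>R (V *v x)"
    unfolding scaleR_matrix_vector matrix_vector_mult_diff_rdistrib Pn using assms
    by (simp add: matrix_vector_scaleR algebra_simps
        bounded_bilinear.minus_right[OF bounded_bilinear_matrix_vector_mult])
  ultimately show ?thesis
    by (simp add: n)
qed

text \<open>The derivative satisfies the same equation with \<open>V ** K\<close> in place of
  \<open>A ** V\<close>. As \<open>V *v x = v\<close>, the inhomogeneous terms cancel and only the
  defect of the Krylov relation survives.\<close>

lemma residual_krylov:
  fixes K :: "complex^'k^'k" and V :: "complex^'k^'n"
  assumes "l \<ge> 1" "t \<noteq> 0" "V *v x = v"
  shows "residual l A v (\<lambda>s. V *v (matfun (phi l) ((- s) *\<^sub>R K) *v x)) t
       = (V ** K - A ** V) *v (matfun (phi l) ((- t) *\<^sub>R K) *v x)"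
  using vector_derivative_at[OF has_vector_derivative_matfun_phi_mult[OF assms(1,2), of V K x]] assms(3)
  by (simp add: residual_def matrix_vector_mult_diff_rdistrib matrix_vector_mul_assoc[symmetric])

section \<open>Rank-one perturbations\<close>

text \<open>Splitting off one left factor of \<open>H + couter g u\<close> applies \<open>H\<close>
  to the previous difference and adds one new multiple of \<open>g\<close>, the term
  \<open>p = m\<close>.\<close>

lemma matpow_rank_one_perturbation:
  fixes H :: "complex^'k^'k"
  shows "matpow (H + couter g u) m *v x - matpow H m *v x
     = (\<Sum>p<m. cdot u (matpow (H + couter g u) p *v x) *s (matpow H (m - 1 - p) *v g))"
proof (induction m)
  case (Suc m)
  let ?T = "H + couter g u"
  let ?c = "\<lambda>p. cdot u (matpow ?T p *v x)"
  have "matpow ?T (Suc m) *v x - matpow H (Suc m) *v x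
      = H *v (matpow ?T m *v x - matpow H m *v x) + ?c m *s g"
    by (simp add: matrix_vector_mul_assoc[symmetric] matrix_vector_mult_add_rdistrib couter_mult_vec
        algebra_simps)
  also have "\<dots> = (\<Sum>p<m. ?c p *s (H *v (matpow H (m - 1 - p) *v g))) + ?c m *s g"
    unfolding Suc by (simp add: linear_sum[OF matrix_vector_mul_linear] matrix_vector_mult_smult)
  also have "(\<Sum>p<m. ?c p *s (H *v (matpow H (m - 1 - p) *v g)))
      = (\<Sum>p<m. ?c p *s (matpow H (m - p) *v g))"
  proof (intro sum.cong refl)
    fix p assume "p \<in> {..<m}"
    then have "m - p = Suc (m - 1 - p)" by auto
    then show "?c p *s (H *v (matpow H (m - 1 - p) *v g)) = ?c p *s (matpow H (m - p) *v g)"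
      by (simp add: matrix_vector_mul_assoc)
  qed
  finally show ?case by simp
qed simp

text \<open>Subtracting the recurrences for \<open>T\<close> and \<open>H\<close> cancels the
  \<open>1 / fact l\<close> terms. Solving for the next difference by \<open>P\<close> contributes
  one more summand and raises every earlier power of \<open>P\<close> by one.\<close>

lemma matfun_phi_rank_one_perturbation:
  fixes H :: "complex^'k^'k" and g u x :: "complex^'k"
  assumes H: "invertible H" and t: "t \<noteq> 0"
  defines "T \<equiv> H + couter g u" and "P \<equiv> matrix_inv ((- t) *\<^sub>R H)"
  shows "matfun (phi l) ((- t) *\<^sub>R T) *v x - matfun (phi l) ((- t) *\<^sub>R H) *v x
     = matpow P l *v (matfun (phi 0) ((- t) *\<^sub>R T) *v x - matfun (phi 0) ((- t) *\<^sub>R H) *v x)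
       - (\<Sum>j=1..l. cdot u (matfun (phi j) ((- t) *\<^sub>R T) *v x) *s (matpow P (l - j) *v (matrix_inv H *v g)))"
proof (induction l)
  case 0
  then show ?case by simp
next
  case (Suc l)
  let ?D = "\<lambda>l. matfun (phi l) ((- t) *\<^sub>R T) *v x - matfun (phi l) ((- t) *\<^sub>R H) *v x"
  let ?c = "\<lambda>j. cdot u (matfun (phi j) ((- t) *\<^sub>R T) *v x)"
  let ?Hg = "matrix_inv H *v g"
  let ?N = "(- t) *\<^sub>R H"
  have "invertible ?N" using scalar_invertible[of "- t" H] H t by simp
  note P = matrix_inv_invertible[OF this, folded P_def]
  have Hg: "H *v ?Hg = g"
    by (simp add: matrix_vector_mul_assoc matrix_inv_invertible[OF H])
  have rec: "((- t) *\<^sub>R X) *v (matfun (phi (Suc l)) ((- t) *\<^sub>R X) *v x)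
      = matfun (phi l) ((- t) *\<^sub>R X) *v x - (1 / fact l) *\<^sub>R x" for X :: "complex^'k^'k"
    unfolding matrix_vector_mul_assoc matfun_phi_Suc
    by (simp add: matrix_vector_mult_diff_rdistrib scaleR_matrix_vector)
  \<comment> \<open>The rank-one part of \<open>T\<close> is moved to the other side, so that both
    recurrences have the same matrix \<open>?N\<close> on the left and can be subtracted.\<close>
  have "((- t) *\<^sub>R T) *v z = ?N *v z - t *\<^sub>R (cdot u z *s g)" for z
    by (simp add: T_def scaleR_matrix_vector matrix_vector_mult_add_rdistrib couter_mult_vec
        scaleR_add_right del: scaleR_minus_left) simp
  then have rec_T: "?N *v (matfun (phi (Suc l)) ((- t) *\<^sub>R T) *v x)
      = matfun (phi l) ((- t) *\<^sub>R T) *v x - (1 / fact l) *\<^sub>R x + t *\<^sub>R (?c (Suc l) *s g)"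
    using rec[of T] by (simp only: diff_eq_eq)
  have "?N *v (?D (Suc l)) = ?D l + t *\<^sub>R (?c (Suc l) *s g)"
    unfolding matrix_vector_mult_diff_distrib rec_T rec[of H] by simp
  \<comment> \<open>Rewriting \<open>g\<close> as \<open>H *v ?Hg\<close> exhibits this term as an
    image under \<open>?N\<close>, so \<open>P\<close> cancels it without leaving a factor of
    \<open>t\<close>.\<close>
  also have "t *\<^sub>R (?c (Suc l) *s g) = - (?N *v (?c (Suc l) *s ?Hg))"
    unfolding matrix_vector_mult_smult scaleR_matrix_vector Hg by (simp add: vec_eq_iff)
  finally have "P *v (?N *v (?D (Suc l))) = P *v (?D l) - P *v (?N *v (?c (Suc l) *s ?Hg))"
    by (simp add: matrix_vector_mult_diff_distrib)
  then have "?D (Suc l) = P *v (?D l) - ?c (Suc l) *s ?Hg"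
    unfolding matrix_vector_mul_assoc P by simp
  also have "P *v (?D l) = matpow P (Suc l) *v (?D 0)
      - (\<Sum>j=1..l. ?c j *s (P *v (matpow P (l - j) *v ?Hg)))"
    unfolding Suc
    by (simp add: matrix_vector_mult_diff_distrib linear_sum[OF matrix_vector_mul_linear]
        matrix_vector_mult_smult matrix_vector_mul_assoc[symmetric])
  also have "(\<Sum>j=1..l. ?c j *s (P *v (matpow P (l - j) *v ?Hg)))
      = (\<Sum>j=1..l. ?c j *s (matpow P (Suc l - j) *v ?Hg))"
    by (intro sum.cong refl) (auto simp: matrix_vector_mul_assoc[symmetric] Suc_diff_le)
  finally show ?case by simp
qed

section \<open>The difference of the two matrix functions as a series, and its integral\<close>

lemma bounded_linear_cdot: "bounded_linear (cdot u)"
proof -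
  have "linear (cdot u)"
    by (simp add: linear_iff cdot_def distrib_left sum.distrib scaleR_right.sum)
  then show ?thesis by (simp add: linear_conv_bounded_linear)
qed

lemma cdot_scaleR: "cdot u (r *\<^sub>R x) = of_real r * cdot u x"
  by (simp add: cdot_def scaleR_conv_of_real[where 'a = complex] sum_distrib_left mult_ac)

lemma cdot_smult: "cdot u (c *s x) = c * cdot u x"
  by (simp add: cdot_def sum_distrib_left mult_ac)

text \<open>This is how \<open>k \<ge> 2\<close> enters: it makes the first and last unit vectors
  orthogonal.\<close>

lemma first_idx_neq_last_idx:
  assumes "CARD('k::{finite,linorder}) \<ge> 2"
  shows "(first_idx :: 'k) \<noteq> last_idx"
proof
  assume eq: "(first_idx :: 'k) = last_idx"
  have "i = first_idx" for i :: 'k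
  proof (rule order.antisym)
    show "i \<le> first_idx" unfolding eq last_idx_def by simp
    show "first_idx \<le> i" unfolding first_idx_def by simp
  qed
  then have "(UNIV :: 'k set) = {first_idx}" by auto
  then have "CARD('k) = 1" by (metis card_1_singleton_iff One_nat_def)
  with assms show False by simp
qed

locale rank_one_perturbation =
  fixes H T :: "complex^'k^'k" and u g x :: "complex^'k"
  assumes T_eq: "T = H + couter g u"
    and cdot_x: "cdot u x = 0"
begin

text \<open>The inner sum in the form used by the theorem, starting at \<open>p = 1\<close>.
  Truncated subtraction makes the range empty for \<open>m = 0\<close> as well as for
  \<open>m = 1\<close>.\<close>

definition coeff :: "nat \<Rightarrow> complex^'k" where
  "coeff m = (\<Sum>p=1..m-1. cdot u (matpow T p *v x) *s (matpow H (m - 1 - p) *v g))"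

lemma coeff_eq: "coeff m = matpow T m *v x - matpow H m *v x"
proof (cases m)
  case 0
  then show ?thesis by (simp add: coeff_def)
next
  case (Suc n)
  \<comment> \<open>The telescoped sum also has a term \<open>p = 0\<close>, whose scalar factor is
    \<open>cdot u x = 0\<close>.\<close>
  have "{..<m} = insert 0 {1..m - 1}"
    using Suc by auto
  then show ?thesis
    by (simp add: coeff_def matpow_rank_one_perturbation[of H g u, folded T_eq] cdot_x)
qed

lemma coeff_0 [simp]: "coeff 0 = 0" and coeff_1 [simp]: "coeff (Suc 0) = 0"
  by (simp_all add: coeff_def)

lemma summable_norm_coeff: "summable (\<lambda>m. norm ((s ^ m / fact (m + l)) *\<^sub>R coeff m))"
proof -
  obtain B where B: "\<And>X :: complex^'k^'k. norm (X *v x) \<le> norm X * B"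
    using bounded_linear.bounded[OF bounded_linear_matrix_vector_left[of x]] by auto
  let ?n = "\<lambda>K m. norm ((s ^ m / fact (m + l)) *\<^sub>R matpow K m) * B"
  show ?thesis
  proof (rule summable_comparison_test[OF exI[of _ 0]])
    show "summable (\<lambda>m. ?n T m + ?n H m)"
      by (intro summable_add summable_mult2 summable_norm_matpow)
    show "\<forall>m\<ge>0. norm (norm ((s ^ m / fact (m + l)) *\<^sub>R coeff m)) \<le> ?n T m + ?n H m"
    proof (intro allI impI)
      fix m
      have "(s ^ m / fact (m + l)) *\<^sub>R coeff m
          = ((s ^ m / fact (m + l)) *\<^sub>R matpow T m) *v x - ((s ^ m / fact (m + l)) *\<^sub>R matpow H m) *v x"
        by (simp add: coeff_eq scaleR_matrix_vector scaleR_diff_right)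
      also have "norm \<dots> \<le> ?n T m + ?n H m"
        by (rule order_trans[OF norm_triangle_ineq4 add_mono[OF B B]])
      finally show "norm (norm ((s ^ m / fact (m + l)) *\<^sub>R coeff m)) \<le> ?n T m + ?n H m"
        by simp
    qed
  qed
qed

lemma coeff_sums:
  "(\<lambda>m. (s ^ m / fact (m + l)) *\<^sub>R coeff m)
     sums (matfun (phi l) (s *\<^sub>R T) *v x - matfun (phi l) (s *\<^sub>R H) *v x)"
  using sums_diff[OF matfun_phi_mult_sums[of s l T x] matfun_phi_mult_sums[of s l H x]]
  by (simp add: coeff_eq scaleR_diff_right)

lemma coeff_has_sum:
  "((\<lambda>m. (s ^ m / fact m) *\<^sub>R coeff m)
     has_sum (matfun (phi 0) (s *\<^sub>R T) *v x - matfun (phi 0) (s *\<^sub>R H) *v x)) {2..}"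
  using summable_norm_coeff[of s 0] coeff_sums[of s 0]
  by (intro has_sum_from_2) auto

lemma cdot_coeff:
  "cdot w (coeff m) = (\<Sum>p=1..m-1. cdot u (matpow T p *v x) * cdot w (matpow H (m - 1 - p) *v g))"
  unfolding coeff_def
  by (simp add: linear_sum[OF bounded_linear.linear[OF bounded_linear_cdot]] cdot_smult)

text \<open>The integrand of \<open>\<rho>\<close> is the \<open>phi 0\<close> difference at
  parameter \<open>t * (\<theta> - 1)\<close>. The value is written as an ordered series with
  coefficients free of \<open>\<theta>\<close>, the form needed for termwise integration.\<close>

lemma cdot_coeff_has_sum:
  "((\<lambda>m. of_real (t ^ m * (\<theta> - 1) ^ m / fact m) * cdot w (coeff m))
     has_sum (\<Sum>m. (((1 - \<theta>) ^ m / fact m) *\<^sub>R cdot w ((- t) ^ m *\<^sub>R coeff m)))) {2..}"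
proof -
  let ?s = "- t * (1 - \<theta>)"
  have *: "of_real (t ^ m * (\<theta> - 1) ^ m / fact m) * cdot w (coeff m)
      = cdot w ((?s ^ m / fact m) *\<^sub>R coeff m)"
     "((1 - \<theta>) ^ m / fact m) *\<^sub>R cdot w ((- t) ^ m *\<^sub>R coeff m) = cdot w ((?s ^ m / fact m) *\<^sub>R coeff m)" for m
  proof -
    have "t ^ m * (\<theta> - 1) ^ m = ?s ^ m"
      by (simp flip: power_mult_distrib add: algebra_simps)
    then show "of_real (t ^ m * (\<theta> - 1) ^ m / fact m) * cdot w (coeff m)
        = cdot w ((?s ^ m / fact m) *\<^sub>R coeff m)"
      by (simp add: cdot_scaleR)
    show "((1 - \<theta>) ^ m / fact m) *\<^sub>R cdot w ((- t) ^ m *\<^sub>R coeff m) = cdot w ((?s ^ m / fact m) *\<^sub>R coeff m)"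
      unfolding power_mult_distrib by (simp add: cdot_scaleR scaleR_conv_of_real[where 'a = complex])
  qed
  note cs = has_sum_bounded_linear[OF bounded_linear_cdot[of w] coeff_has_sum[of ?s]]
    bounded_linear.sums[OF bounded_linear_cdot[of w] coeff_sums[of ?s 0]]
  show ?thesis unfolding * using cs by (simp add: o_def sums_iff)
qed

text \<open>Integration against \<open>\<theta> ^ n\<close> replaces \<open>1 / fact m\<close> by
  \<open>fact n / fact (m + n + 1)\<close>, that is, \<open>fact n\<close> times the Taylor
  coefficient of \<open>phi (Suc n)\<close>. Hence the \<open>phi 0\<close> difference turns into
  the \<open>phi (Suc n)\<close> difference.\<close>

lemma cdot_coeff_has_integral:
  "((\<lambda>\<theta>. (\<Sum>\<^sub>\<infinity>m\<in>{2..}. of_real (t ^ m * (\<theta> - 1) ^ m / fact m) * cdot w (coeff m)) * of_real (\<theta> ^ n))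
     has_integral fact n * cdot w (matfun (phi (Suc n)) ((- t) *\<^sub>R T) *v x - matfun (phi (Suc n)) ((- t) *\<^sub>R H) *v x))
   {0..1}"
proof -
  let ?a = "\<lambda>m. cdot w ((- t) ^ m *\<^sub>R coeff m)"
  obtain B where B: "\<And>y. norm (cdot w y) \<le> norm y * B"
    using bounded_linear.bounded[OF bounded_linear_cdot[of w]] by auto
  have sm: "summable (\<lambda>m. norm (?a m) / fact m)"
  proof (rule summable_comparison_test[OF exI[of _ 0]])
    show "summable (\<lambda>m. norm (((- t) ^ m / fact (m + 0)) *\<^sub>R coeff m) * B)"
      by (intro summable_mult2 summable_norm_coeff)
    show "\<forall>m\<ge>0. norm (norm (?a m) / fact m) \<le> norm (((- t) ^ m / fact (m + 0)) *\<^sub>R coeff m) * B"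
    proof (intro allI impI)
      fix m
      show "norm (norm (?a m) / fact m) \<le> norm (((- t) ^ m / fact (m + 0)) *\<^sub>R coeff m) * B"
        using divide_right_mono[OF B[of "(- t) ^ m *\<^sub>R coeff m"], of "fact m"] by simp
    qed
  qed
  have "(\<Sum>m. ((1 - \<theta>) ^ m * \<theta> ^ n / fact m) *\<^sub>R ?a m)
      = (\<Sum>\<^sub>\<infinity>m\<in>{2..}. of_real (t ^ m * (\<theta> - 1) ^ m / fact m) * cdot w (coeff m)) * of_real (\<theta> ^ n)" 
    if "\<theta> \<in> {0..1}" for \<theta> :: real
  proof -
    \<comment> \<open>Convergence is needed to pull the factor \<open>\<theta> ^ n\<close> out of
      the series.\<close>
    have "summable (\<lambda>m. ((1 - \<theta>) ^ m / fact m) *\<^sub>R ?a m)"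
    proof (rule summable_comparison_test[OF exI[of _ 0]])
      show "\<forall>m\<ge>0. norm (((1 - \<theta>) ^ m / fact m) *\<^sub>R ?a m) \<le> norm (?a m) / fact m"
      proof (intro allI impI)
        fix m
        have "(1 - \<theta>) ^ m * norm (?a m) \<le> 1 * norm (?a m)"
          using that by (intro mult_right_mono power_le_one) auto
        then show "norm (((1 - \<theta>) ^ m / fact m) *\<^sub>R ?a m) \<le> norm (?a m) / fact m"
          using that by (simp add: divide_right_mono)
      qed
    qed (rule sm)
    then have "(\<Sum>m. \<theta> ^ n *\<^sub>R (((1 - \<theta>) ^ m / fact m) *\<^sub>R ?a m))
       = \<theta> ^ n *\<^sub>R (\<Sum>m. ((1 - \<theta>) ^ m / fact m) *\<^sub>R ?a m)"
      by (rule suminf_scaleR_right[symmetric])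
    then show ?thesis
      unfolding infsumI[OF cdot_coeff_has_sum] by (simp add: scaleR_conv_of_real mult_ac)
  qed
  from has_integral_eq[OF this has_integral_beta_series[OF sm]]
  have "((\<lambda>\<theta>. (\<Sum>\<^sub>\<infinity>m\<in>{2..}. of_real (t ^ m * (\<theta> - 1) ^ m / fact m) * cdot w (coeff m)) * of_real (\<theta> ^ n))
     has_integral (\<Sum>m. (fact n / fact (m + n + 1)) *\<^sub>R ?a m)) {0..1}" .
  also have "(\<Sum>m. (fact n / fact (m + n + 1)) *\<^sub>R ?a m) 
      = (\<Sum>m. cdot w (fact n *\<^sub>R (((- t) ^ m / fact (m + Suc n)) *\<^sub>R coeff m)))"
    by (simp add: linear_scale[OF bounded_linear.linear[OF bounded_linear_cdot]] mult_ac)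
  also have "\<dots> = cdot w (fact n *\<^sub>R
      (matfun (phi (Suc n)) ((- t) *\<^sub>R T) *v x - matfun (phi (Suc n)) ((- t) *\<^sub>R H) *v x))"
    by (rule sums_unique[symmetric], rule bounded_linear.sums[OF bounded_linear_cdot],
        rule sums_scaleR_right, rule coeff_sums)
  also have "\<dots> = fact n * cdot w (matfun (phi (Suc n)) ((- t) *\<^sub>R T) *v x - matfun (phi (Suc n)) ((- t) *\<^sub>R H) *v x)"
    by (simp add: cdot_scaleR)
  finally show ?thesis .
qed

end

section \<open>Assembling the error and residual identities\<close>

lemma matpowi_minus: "matpowi M (- int n) = matpow (matrix_inv M) n"
  by (cases "n = 0") (simp_all add: matpowi_def)

lemma matrix_vector_mult_axis: "V *v axis i 1 = column i V"
proof -
  have "(\<Sum>j\<in>UNIV. V $ p $ j * axis i 1 $ j) = (\<Sum>j\<in>UNIV. if j = i then V $ p $ j else 0)" for p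
    by (intro sum.cong) (auto simp: axis_def)
  then show ?thesis
    by (simp add: vec_eq_iff column_def matrix_vector_mult_def)
qed

theorem theorem3p2:
  fixes A :: "complex^'n^'n" and v w :: "complex^'n"
    and V :: "complex^'k::{finite,linorder}^'n"
    and H T :: "complex^'k::{finite,linorder}^'k::{finite,linorder}" and e1 ek g :: "complex^'k::{finite,linorder}"
    and y yhat :: "real \<Rightarrow> complex^'n"
    and h \<gamma> t \<beta> :: real and \<rho> :: complex and l :: nat
  assumes "l \<ge> 1" and "CARD('k) \<ge> 2" and "t > 0" and "v \<noteq> 0" and "\<gamma> \<noteq> 0"
    and "\<forall>\<mu> \<in> mat_spectrum ((- t) *\<^sub>R A). Re \<mu> \<le> 0"
    and "arnoldi A v V w H h"
    and "invertible H"
    and "invertible (mat 1 + \<gamma> *\<^sub>R H)"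
    and "\<beta> = norm v"
    and "e1 = axis first_idx 1" and "ek = axis last_idx 1"
    and "T = H + (\<gamma> * h\<^sup>2) *\<^sub>R
           (matrix_inv (conj_transpose (mat 1 + \<gamma> *\<^sub>R H)) ** couter ek ek)"
    and "g = (\<gamma> * h\<^sup>2) *\<^sub>R (matrix_inv (conj_transpose (mat 1 + \<gamma> *\<^sub>R H)) *v ek)"
    and "y = (\<lambda>s. V *v (matfun (phi l) ((- s) *\<^sub>R H) *v (\<beta> *\<^sub>R e1)))"
    and "yhat = (\<lambda>s. V *v (matfun (phi l) ((- s) *\<^sub>R T) *v (\<beta> *\<^sub>R e1)))"
    and "\<rho> = of_real (\<beta> / fact (l - 1)) *
           integral {0..1} (\<lambda>\<theta>::real.
             (\<Sum>\<^sub>\<infinity>m\<in>{2..}. of_real (t ^ m * (\<theta> - 1) ^ m / fact m) *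
                (\<Sum>p=1..m-1. cdot ek (matpow T p *v e1) * cdot ek (matpow H (m - 1 - p) *v g)))
             * of_real (\<theta> ^ (l - 1)))"
  shows
    "\<comment> \<open>the derivatives, series and integral below exist\<close>
     y differentiable (at t) \<and> yhat differentiable (at t) \<and>
     (\<lambda>m. ((- t) ^ m / fact m) *\<^sub>R
        (\<Sum>p=1..m-1. cdot ek (matpow T p *v e1) *s (matpow H (m - 1 - p) *v g)))
       summable_on {2..} \<and>
     (\<forall>\<theta>\<in>{0..1}.
        (\<lambda>m. of_real (t ^ m * (\<theta> - 1) ^ m / fact m) *
           (\<Sum>p=1..m-1. cdot ek (matpow T p *v e1) * cdot ek (matpow H (m - 1 - p) *v g)))
          summable_on {2..}) \<and>
     (\<lambda>\<theta>::real.
        (\<Sum>\<^sub>\<infinity>m\<in>{2..}. of_real (t ^ m * (\<theta> - 1) ^ m / fact m) *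
           (\<Sum>p=1..m-1. cdot ek (matpow T p *v e1) * cdot ek (matpow H (m - 1 - p) *v g)))
        * of_real (\<theta> ^ (l - 1))) integrable_on {0..1} \<and>
     \<comment> \<open>the two identities\<close>
     yhat t - y t =
       V *v (matpowi ((- t) *\<^sub>R H) (- int l) *v
               (\<beta> *\<^sub>R (\<Sum>\<^sub>\<infinity>m\<in>{2..}. ((- t) ^ m / fact m) *\<^sub>R
                  (\<Sum>p=1..m-1. cdot ek (matpow T p *v e1) *s (matpow H (m - 1 - p) *v g))))
             - (\<Sum>j=1..l. cdot ek (matfun (phi j) ((- t) *\<^sub>R T) *v (\<beta> *\<^sub>R e1)) *s
                  (matpowi ((- t) *\<^sub>R H) (- int l + int j) *v (matrix_inv H *v g)))) \<and>
     residual l A v yhat t =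
       residual l A v y t - (of_real h * \<rho>) *s w
       + (of_real (\<gamma> * h\<^sup>2) *
            (cdot ek (matfun (phi l) ((- t) *\<^sub>R H) *v (\<beta> *\<^sub>R e1)) + \<rho>)) *s
           (V *v (matrix_inv (conj_transpose (mat 1 + \<gamma> *\<^sub>R H)) *v ek))"
proof -
  obtain n where l: "l = Suc n" using assms(1) by (cases l) auto
  note T_def = assms(13) and g_def = assms(14) and y_def = assms(15) and yhat_def = assms(16)
    and rho_def = assms(17)
  let ?G = "matrix_inv (conj_transpose (mat 1 + \<gamma> *\<^sub>R H))"
  let ?PT = "\<lambda>l x. matfun (phi l) ((- t) *\<^sub>R T) *v x"
  let ?PH = "\<lambda>l x. matfun (phi l) ((- t) *\<^sub>R H) *v x"
  \<comment> \<open>The matrix factor and the scalar are absorbed into the left vector of the outer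
    product, which becomes \<open>g\<close>.\<close>
  have T_eq: "T = H + couter g ek"
    by (simp add: T_def g_def matrix_mult_couter couter_scaleR_left)
  have e1_ek: "cdot ek e1 = 0"
    using first_idx_neq_last_idx[OF assms(2)]
    unfolding assms(11,12) cdot_axis by (simp add: axis_def)
  interpret rank_one_perturbation H T ek g e1
    by standard (fact T_eq, fact e1_ek)
  have beta_PT: "?PT l (\<beta> *\<^sub>R e1) - ?PH l (\<beta> *\<^sub>R e1) = \<beta> *\<^sub>R (?PT l e1 - ?PH l e1)" for l
    by (simp add: matrix_vector_scaleR scaleR_diff_right)

  have A_V: "A ** V = V ** H + h *\<^sub>R couter w ek" and col: "column first_idx V = v /\<^sub>R norm v"
    using assms(7,12) by (auto simp: arnoldi_def)
  have V_e1: "V *v (\<beta> *\<^sub>R e1) = v"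
    using assms(4,10,11) col by (simp add: matrix_vector_scaleR matrix_vector_mult_axis)
  have diff: "y differentiable (at t)" "yhat differentiable (at t)"
    unfolding y_def yhat_def using assms(1,3)
    by (intro differentiableI_vector[OF has_vector_derivative_matfun_phi_mult]; simp)+

  have infsum_coeff: "(\<Sum>\<^sub>\<infinity>m\<in>{2..}. ((- t) ^ m / fact m) *\<^sub>R coeff m) = ?PT 0 e1 - ?PH 0 e1"
    by (rule infsumI[OF coeff_has_sum])
  have "yhat t - y t = V *v (?PT l (\<beta> *\<^sub>R e1) - ?PH l (\<beta> *\<^sub>R e1))"
    by (simp add: y_def yhat_def matrix_vector_mult_diff_distrib)
  also have "?PT l (\<beta> *\<^sub>R e1) - ?PH l (\<beta> *\<^sub>R e1)
      = matpow (matrix_inv ((- t) *\<^sub>R H)) l *v (?PT 0 (\<beta> *\<^sub>R e1) - ?PH 0 (\<beta> *\<^sub>R e1))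
        - (\<Sum>j=1..l. cdot ek (?PT j (\<beta> *\<^sub>R e1)) *s
             (matpow (matrix_inv ((- t) *\<^sub>R H)) (l - j) *v (matrix_inv H *v g)))"
    using assms(3,8) unfolding T_eq by (intro matfun_phi_rank_one_perturbation) auto
  also have "(\<Sum>j=1..l. cdot ek (?PT j (\<beta> *\<^sub>R e1)) *s
             (matpow (matrix_inv ((- t) *\<^sub>R H)) (l - j) *v (matrix_inv H *v g)))
      = (\<Sum>j=1..l. cdot ek (?PT j (\<beta> *\<^sub>R e1)) *s
             (matpowi ((- t) *\<^sub>R H) (- int l + int j) *v (matrix_inv H *v g)))"
  proof (intro sum.cong refl)
    fix j assume "j \<in> {1..l}"
    \<comment> \<open>The exponent is nonpositive on this range, so the natural number
      \<open>l - j\<close> is an exact difference.\<close>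
    then have "- int l + int j = - int (l - j)" by auto
    then show "cdot ek (?PT j (\<beta> *\<^sub>R e1)) *s
             (matpow (matrix_inv ((- t) *\<^sub>R H)) (l - j) *v (matrix_inv H *v g))
        = cdot ek (?PT j (\<beta> *\<^sub>R e1)) *s
             (matpowi ((- t) *\<^sub>R H) (- int l + int j) *v (matrix_inv H *v g))"
      by (simp only: matpowi_minus)
  qed
  also have "?PT 0 (\<beta> *\<^sub>R e1) - ?PH 0 (\<beta> *\<^sub>R e1)
      = \<beta> *\<^sub>R (\<Sum>\<^sub>\<infinity>m\<in>{2..}. ((- t) ^ m / fact m) *\<^sub>R coeff m)"
    unfolding beta_PT infsum_coeff ..
  also have "matpow (matrix_inv ((- t) *\<^sub>R H)) l = matpowi ((- t) *\<^sub>R H) (- int l)"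
    by (simp only: matpowi_minus)
  finally have error: "yhat t - y t = V *v (matpowi ((- t) *\<^sub>R H) (- int l) *v
         (\<beta> *\<^sub>R (\<Sum>\<^sub>\<infinity>m\<in>{2..}. ((- t) ^ m / fact m) *\<^sub>R coeff m))
       - (\<Sum>j=1..l. cdot ek (?PT j (\<beta> *\<^sub>R e1)) *s
             (matpowi ((- t) *\<^sub>R H) (- int l + int j) *v (matrix_inv H *v g))))" .

  let ?f = "\<lambda>\<theta>. (\<Sum>\<^sub>\<infinity>m\<in>{2..}. of_real (t ^ m * (\<theta> - 1) ^ m / fact m) * cdot ek (coeff m)) * of_real (\<theta> ^ n)"
  have int: "(?f has_integral fact n * cdot ek (?PT l e1 - ?PH l e1)) {0..1}"
    using cdot_coeff_has_integral[of t ek n] by (simp only: l)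
  \<comment> \<open>The factor \<open>fact n\<close> from the integral cancels the denominator,
    identifying \<open>\<rho>\<close> with the last component of the difference of the two
    \<open>phi l\<close> vectors.\<close>
  have "\<rho> = of_real (\<beta> / fact n) * integral {0..1} ?f"
    unfolding rho_def cdot_coeff l by simp
  also have "\<dots> = of_real \<beta> * cdot ek (?PT l e1 - ?PH l e1)"
    unfolding integral_unique[OF int] by simp
  also have "\<dots> = cdot ek (?PT l (\<beta> *\<^sub>R e1) - ?PH l (\<beta> *\<^sub>R e1))"
    unfolding beta_PT
    by (simp only: cdot_scaleR)
  finally have rho: "cdot ek (?PT l (\<beta> *\<^sub>R e1)) = cdot ek (?PH l (\<beta> *\<^sub>R e1)) + \<rho>"
    by (simp add: linear_diff[OF bounded_linear.linear[OF bounded_linear_cdot]])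

  have res: "residual l A v (\<lambda>s. V *v (matfun (phi l) ((- s) *\<^sub>R K) *v (\<beta> *\<^sub>R e1))) t
       = (V ** K - A ** V) *v (matfun (phi l) ((- t) *\<^sub>R K) *v (\<beta> *\<^sub>R e1))" for K
    using assms(1,3) V_e1 by (intro residual_krylov) auto
  have "residual l A v y t = (- h *\<^sub>R couter w ek) *v ?PH l (\<beta> *\<^sub>R e1)"
    unfolding y_def res A_V by simp
  also have "\<dots> = - (of_real h * cdot ek (?PH l (\<beta> *\<^sub>R e1))) *s w"
    unfolding scaleR_matrix_vector couter_mult_vec
    by (simp add: vec_eq_iff scaleR_conv_of_real[where 'a = complex])
  finally have res_y: "residual l A v y t = - (of_real h * cdot ek (?PH l (\<beta> *\<^sub>R e1))) *s w" .
  \<comment> \<open>Relative to \<open>H\<close>, the perturbation adds a defect along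
    \<open>V *v g\<close> to the one along \<open>w\<close>; both see only the last component of the
    \<open>phi l\<close> vector, which \<open>rho\<close> then rewrites.\<close>
  have "V ** T - A ** V = couter (V *v g) ek - h *\<^sub>R couter w ek"
    unfolding A_V T_eq by (simp add: matrix_add_ldistrib matrix_mult_couter)
  then have "residual l A v yhat t = (couter (V *v g) ek - h *\<^sub>R couter w ek) *v ?PT l (\<beta> *\<^sub>R e1)"
    unfolding yhat_def res by simp
  also have "\<dots> = cdot ek (?PT l (\<beta> *\<^sub>R e1)) *s (V *v g)
      - (of_real h * cdot ek (?PT l (\<beta> *\<^sub>R e1))) *s w"
    unfolding scaleR_matrix_vector matrix_vector_mult_diff_rdistrib couter_mult_vec
    by (simp add: vec_eq_iff scaleR_conv_of_real[where 'a = complex])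
  also have "V *v g = (\<gamma> * h\<^sup>2) *\<^sub>R (V *v (?G *v ek))"
    unfolding g_def by (rule matrix_vector_scaleR)
  finally have residual: "residual l A v yhat t = residual l A v y t - (of_real h * \<rho>) *s w
       + (of_real (\<gamma> * h\<^sup>2) * (cdot ek (?PH l (\<beta> *\<^sub>R e1)) + \<rho>)) *s (V *v (?G *v ek))"
    unfolding res_y rho by (simp add: vec_eq_iff scaleR_conv_of_real[where 'a = complex] algebra_simps)

  have "(\<lambda>m. ((- t) ^ m / fact m) *\<^sub>R coeff m) summable_on {2..}"
    by (rule has_sum_imp_summable[OF coeff_has_sum])
  moreover have "\<forall>\<theta>\<in>{0..1}. (\<lambda>m. of_real (t ^ m * (\<theta> - 1) ^ m / fact m) * cdot ek (coeff m)) summable_on {2..}"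
    using has_sum_imp_summable[OF cdot_coeff_has_sum] by blast
  moreover have "(\<lambda>\<theta>::real. (\<Sum>\<^sub>\<infinity>m\<in>{2..}. of_real (t ^ m * (\<theta> - 1) ^ m / fact m) * cdot ek (coeff m))
        * of_real (\<theta> ^ (l - 1))) integrable_on {0..1}"
    using has_integral_integrable[OF int] by (simp only: l diff_Suc_1)
  \<comment> \<open>The scalar sums are expanded by \<open>cdot_coeff\<close> first, before
    unfolding \<open>coeff_def\<close> would hide the pattern
    \<open>cdot ek (coeff m)\<close>.\<close>
  ultimately show ?thesis
    using diff error residual unfolding cdot_coeff unfolding coeff_def by (intro conjI)
qed

end
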